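(* Let $p$ be a fixed prime, let $S=\{1,2,\dots,p-1\}$, and let $m$ be any positive integer dividing $p-1$. As $g$ ranges over all integers not divisible by $p$, there are exactly $\phi\left(\frac{p-1}{m}\right)$ different $m$-ary functional graphs among those produced by the maps $f_g:S\to S$, $x\mapsto g^x \bmod p$. Furthermore, if $r$ is any primitive root modulo $p$ and $g\equiv r^a \pmod p$ for an integer $a$, then the functional graph of $f_g$ is $m$-ary if and only if $\gcd(a,p-1)=m$.
   Context: $\phi$ denotes the Euler phi function. For $g$ not divisible by $p$ and $x\in S$, $g^x \bmod p$ denotes the unique element of $S=\{1,\dots,p-1\}$ congruent to $g^x$ modulo $p$. The functional graph of a map $f:S\to S$ is the directed graph with vertex set $S$ having an edge $\langle a,b\rangle$ if and only if $f(a)=b$; two functional graphs on $S$ are different if their edge sets (equivalently, the maps) differ. A functional graph is called $m$-ary if each node has in-degree exactly $0$ or $m$. *)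

theory Defs
  imports "HOL-Number_Theory.Number_Theory" "HOL-Number_Theory.Modular_Inverse"
    "Graph_Theory.Pair_Digraph"
begin

definition functional_graph :: "'a set \<Rightarrow> ('a \<Rightarrow> 'a) \<Rightarrow> 'a pair_pre_digraph" where
  "functional_graph S f = \<lparr>pverts = S, parcs = {(a, b). a \<in> S \<and> b \<in> S \<and> f a = b}\<rparr>"

definition m_ary :: "nat \<Rightarrow> 'a pair_pre_digraph \<Rightarrow> bool" where
  "m_ary m G \<longleftrightarrow>
     (\<forall>v\<in>pverts G. in_degree (with_proj G) v = 0 \<or> in_degree (with_proj G) v = m)"

(* If p is prime and does not divide g, this is the representative of g ^ x in {1..p - 1}. *)
definition exp_map :: "nat \<Rightarrow> int \<Rightarrow> nat \<Rightarrow> nat" where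
  "exp_map p g x = nat (g ^ x mod int p)"

definition exp_graph :: "nat \<Rightarrow> int \<Rightarrow> nat pair_pre_digraph" where
  "exp_graph p g = functional_graph {1..p - 1} (exp_map p g)"

(* residue_primroot is only available on nat, so an integer is replaced by its least
   nonnegative residue. *)
definition primitive_root_mod :: "nat \<Rightarrow> int \<Rightarrow> bool" where
  "primitive_root_mod p r \<longleftrightarrow> residue_primroot p (nat (r mod int p))"

(* A negative exponent denotes a power of the inverse of r modulo p. *)
definition power_int_mod :: "nat \<Rightarrow> int \<Rightarrow> int \<Rightarrow> int" where
  "power_int_mod p r a =
     (if a \<ge> 0 then r ^ nat a else modular_inverse (int p) r ^ nat (- a))"

lemma exp_map_in:
  assumes "prime p" "\<not> int p dvd g"
  shows "exp_map p g x \<in> {1..p - 1}" and "[int (exp_map p g x) = g ^ x] (mod int p)"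
proof -
  have p: "int p > 0" using assms(1) prime_gt_0_nat by simp
  have "\<not> int p dvd g ^ x" using assms prime_dvd_power_int[of "int p" g x] by auto
  then have "g ^ x mod int p \<noteq> 0" by (simp add: dvd_eq_mod_eq_0)
  moreover have "0 \<le> g ^ x mod int p" "g ^ x mod int p < int p" using p by simp_all
  ultimately show "exp_map p g x \<in> {1..p - 1}" unfolding exp_map_def by auto
  show "[int (exp_map p g x) = g ^ x] (mod int p)"
    unfolding exp_map_def using p by (simp add: cong_def)
qed

end

theory Submission
  imports Defs
begin

text \<open>
  Write d for the multiplicative order of g modulo p. The equation f_g(x) = v either has no
  solution or determines x modulo d, in which case it has (p - 1) / d solutions in S. Hence the
  graph of f_g is m-ary precisely if d = (p - 1) / m. Since f_g(1) determines g modulo p, the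
  m-ary graphs correspond to the residues of order (p - 1) / m, and the order of r^a is
  (p - 1) / gcd(a, p - 1).
\<close>

text \<open>The arcs into v are the pairs (x, v) with x in the fibre of f over v, and x determines
  the arc. Questions about degrees thus become questions about sizes of fibres.\<close>

lemma in_degree_functional_graph:
  assumes "v \<in> S"
  shows "in_degree (with_proj (functional_graph S f)) v = card {x \<in> S. f x = v}"
proof -
  have "in_arcs (with_proj (functional_graph S f)) v = (\<lambda>x. (x, v)) ` {x \<in> S. f x = v}"
    using assms by (auto simp: functional_graph_def in_arcs_def)
  then show ?thesis
    unfolding in_degree_def by (simp add: card_image inj_on_def)
qed

text \<open>The interval splits into k blocks of d consecutive numbers, and each block meets the
  residue class exactly once.\<close>

lemma card_cong_class:
  fixes d j k :: nat
  assumes "d > 0"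
  shows "card {x \<in> {1..d * k}. [x = j] (mod d)} = k"
proof -
  \<comment> \<open>The representative of j is taken in {1..d} instead of {0..d - 1} because the
    interval starts at 1. The class is then c, c + d, ..., c + d * (k - 1).\<close>
  define c where "c = (if j mod d = 0 then d else j mod d)"
  have c: "1 \<le> c" "c \<le> d" "[c = j] (mod d)"
    using assms mod_less_divisor[of d j] by (auto simp: c_def cong_def)
  have "{x \<in> {1..d * k}. [x = j] (mod d)} = (\<lambda>i. c + d * i) ` {..<k}"
  proof (intro equalityI subsetI)
    fix x assume "x \<in> {x \<in> {1..d * k}. [x = j] (mod d)}"
    then have x: "1 \<le> x" "x \<le> d * k" "[x = c] (mod d)"
      using c(3) by (auto simp: cong_def)
    \<comment> \<open>A member of the class below c would differ from c by a positive multiple of d,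
      but the distance is less than d. With this bound the natural-number subtraction x - c is
      exact.\<close>
    have "c \<le> x"
    proof (rule ccontr)
      assume "\<not> c \<le> x"
      then have "d dvd c - x" "0 < c - x" "c - x < d"
        using x c by (auto simp: cong_sym_eq cong_altdef_nat)
      then show False by (auto dest: dvd_imp_le)
    qed
    then have "d dvd x - c" using x(3) by (simp add: cong_altdef_nat)
    then obtain i where "x - c = d * i" ..
    then have i: "x = c + d * i" using \<open>c \<le> x\<close> by simp
    then have "d * i < d * k" using x(2) c(1) by linarith
    then have "i < k" by simp
    with i show "x \<in> (\<lambda>i. c + d * i) ` {..<k}" by auto
  next
    fix x assume "x \<in> (\<lambda>i. c + d * i) ` {..<k}"
    then obtain i where i: "i < k" "x = c + d * i" by auto
    \<comment> \<open>Since c \<le> d, this bounds c + d * i by the right end of the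
      interval.\<close>
    have "d * Suc i \<le> d * k" using i(1) by (intro mult_left_mono) auto
    then show "x \<in> {x \<in> {1..d * k}. [x = j] (mod d)}"
      using i c by (auto simp: cong_def)
  qed
  moreover have "inj_on (\<lambda>i. c + d * i) {..<k}"
    using assms by (auto simp: inj_on_def)
  ultimately show ?thesis by (simp add: card_image)
qed

lemma exp_map_of_nat: "exp_map p (int h) x = h ^ x mod p"
proof -
  have "int h ^ x mod int p = int (h ^ x mod p)" by (simp add: zmod_int)
  then show ?thesis unfolding exp_map_def by (simp only: nat_int)
qed

text \<open>Powers of congruent bases are congruent. An integer g may therefore be replaced by a
  natural representative of its residue class, to which \<open>ord\<close> applies.\<close>

lemma exp_graph_cong:
  assumes "[g = g'] (mod int p)"
  shows "exp_graph p g = exp_graph p g'"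
proof -
  have "exp_map p g = exp_map p g'"
    using cong_pow[OF assms] by (auto simp: exp_map_def cong_def fun_eq_iff)
  then show ?thesis by (simp add: exp_graph_def)
qed

text \<open>The edge leaving the vertex 1 ends in h mod p = h, so h can be read off the
  graph.\<close>

lemma exp_graph_inj_on_totatives:
  assumes "prime p"
  shows "inj_on (\<lambda>h. exp_graph p (int h)) (totatives p)"
proof (rule inj_onI)
  fix h h' assume h: "h \<in> totatives p" "h' \<in> totatives p"
    and eq: "exp_graph p (int h) = exp_graph p (int h')"
  have p: "p > 1" using assms prime_gt_1_nat by blast
  have bounds: "0 < h" "h < p" "h' < p"
    using h totatives_less[OF _ p] by (auto simp: totatives_def)
  have "(1, h) \<in> parcs (exp_graph p (int h))"
    using bounds p by (auto simp: exp_graph_def functional_graph_def exp_map_of_nat)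
  then have "(1, h) \<in> parcs (exp_graph p (int h'))" by (simp only: eq)
  then show "h = h'"
    using bounds by (auto simp: exp_graph_def functional_graph_def exp_map_of_nat)
qed

text \<open>Two powers of h agree modulo p exactly if their exponents agree modulo
  \<open>ord p h\<close>. As this order divides p - 1, the solutions form one residue class in an
  interval of full periods.\<close>

lemma card_power_mod_fibre:
  assumes "prime p" "coprime p h"
  shows "card {x \<in> {1..p - 1}. h ^ x mod p = h ^ j mod p} = (p - 1) div ord p h"
proof -
  have d: "ord p h dvd p - 1"
    using order_divides_totient[OF assms(2)] totient_prime[OF assms(1)] by simp
  have pos: "ord p h > 0" using assms(2) by simp
  have "{x \<in> {1..p - 1}. h ^ x mod p = h ^ j mod p} =
      {x \<in> {1..ord p h * ((p - 1) div ord p h)}. [x = j] (mod ord p h)}"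
    using order_divides_expdiff[OF assms(2)] d by (auto simp: cong_def)
  then show ?thesis by (simp only: card_cong_class[OF pos])
qed

text \<open>All nonempty fibres have the same size (p - 1) / \<open>ord p h\<close>, so the only
  in-degrees that can occur are 0 and this number.\<close>

lemma m_ary_exp_graph_iff:
  assumes "prime p" "coprime p h" "m > 0"
  shows "m_ary m (exp_graph p (int h)) \<longleftrightarrow> (p - 1) div ord p h = m"
proof -
  have p: "p > 1" using assms(1) prime_gt_1_nat by blast
  have deg: "in_degree (with_proj (exp_graph p (int h))) v =
      card {x \<in> {1..p - 1}. h ^ x mod p = v}" if "v \<in> {1..p - 1}" for v
    using in_degree_functional_graph[OF that, of "exp_map p (int h)"]
    by (simp only: exp_graph_def exp_map_of_nat)
  have verts: "pverts (exp_graph p (int h)) = {1..p - 1}"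
    by (simp add: exp_graph_def functional_graph_def)
  show ?thesis
  proof
    assume m: "m_ary m (exp_graph p (int h))"
    \<comment> \<open>Being m-ary allows in-degree 0, so a vertex with a preimage is needed. The
      image h mod p of 1 serves.\<close>
    have "\<not> p dvd h" using assms(1,2) p by (auto simp: coprime_absorb_left)
    then have "h mod p > 0" by (simp add: dvd_eq_mod_eq_0)
    moreover have "h mod p < p" using p by simp
    ultimately have v: "h mod p \<in> {1..p - 1}" by auto
    have c: "card {x \<in> {1..p - 1}. h ^ x mod p = h mod p} = (p - 1) div ord p h"
      using card_power_mod_fibre[OF assms(1,2), of 1] by simp
    have "1 \<in> {x \<in> {1..p - 1}. h ^ x mod p = h mod p}" using p by simp
    then have "card {x \<in> {1..p - 1}. h ^ x mod p = h mod p} \<noteq> 0" by auto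
    with m deg[OF v] c v show "(p - 1) div ord p h = m"
      unfolding m_ary_def verts by metis
  next
    assume m: "(p - 1) div ord p h = m"
    show "m_ary m (exp_graph p (int h))"
      unfolding m_ary_def verts
    proof
      fix v assume v: "v \<in> {1..p - 1}"
      show "in_degree (with_proj (exp_graph p (int h))) v = 0 \<or>
          in_degree (with_proj (exp_graph p (int h))) v = m"
      proof (cases "\<exists>j \<in> {1..p - 1}. h ^ j mod p = v")
        case True
        then show ?thesis using deg[OF v] card_power_mod_fibre[OF assms(1,2)] m by auto
      next
        case False
        then have "{x \<in> {1..p - 1}. h ^ x mod p = v} = {}" by auto
        then show ?thesis using deg[OF v] by (simp only: card.empty simp_thms)
      qed
    qed
  qed
qed

text \<open>A primitive root has order p - 1, so an exponent matters only modulo p - 1. This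
  replaces an integer exponent, possibly negative, by a natural one.\<close>

lemma power_int_mod_cong:
  assumes "prime p" "primitive_root_mod p r"
  shows "[power_int_mod p r a = int (nat (r mod int p) ^ nat (a mod int (p - 1)))] (mod int p)"
proof -
  define h where "h = nat (r mod int p)"
  define k where "k = nat (a mod int (p - 1))"
  have p: "p > 1" using assms(1) prime_gt_1_nat by blast
  have h: "coprime p h" "ord p h = p - 1"
    using assms totient_prime[OF assms(1)]
    by (simp_all add: primitive_root_mod_def residue_primroot_def h_def)
  have rh: "[r = int h] (mod int p)" using p by (simp add: h_def cong_def)
  have k: "int k = a mod int (p - 1)" using p by (simp add: k_def)
  have rpow: "[r ^ i = int (h ^ i)] (mod int p)" for i
    using cong_pow[OF rh] by simp
  show ?thesis
  proof (cases "a \<ge> 0")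
    case True
    have "[int (nat a) = int k] (mod int (p - 1))" using True by (simp add: k cong_def)
    then have "[nat a = k] (mod ord p h)" by (simp only: h(2) cong_int_iff)
    then have "[h ^ nat a = h ^ k] (mod p)" using order_divides_expdiff[OF h(1)] by simp
    then have "[int (h ^ nat a) = int (h ^ k)] (mod int p)" by (simp only: cong_int_iff)
    then show ?thesis
      using True rpow[of "nat a"] unfolding power_int_mod_def h_def [symmetric] k_def [symmetric]
      by (auto intro: cong_trans)
  next
    case False
    define n where "n = nat (- a)"
    define s where "s = modular_inverse (int p) r"
    have "coprime r (int p)"
      using cong_imp_coprime[OF cong_sym[OF rh]] h(1) by (simp add: coprime_commute)
    then have "[s * r = 1] (mod int p)" unfolding s_def by (rule cong_modular_inverse2)
    then have sr: "[s ^ n * r ^ n = 1] (mod int p)"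
      using cong_pow[of "s * r" 1 "int p" n] by (simp add: power_mult_distrib)
    \<comment> \<open>Here n = -a, so n + k is the difference of a mod (p - 1) and a, a multiple of
      the order of r.\<close>
    have "int (p - 1) dvd a mod int (p - 1) - a" by (simp add: mod_eq_dvd_iff[symmetric])
    then have "int (p - 1) dvd int (n + k)" using False by (simp add: k n_def)
    then have "ord p h dvd n + k" by (simp only: h(2) int_dvd_int_iff)
    then have "[h ^ (n + k) = 1] (mod p)" by (simp only: ord_divides)
    then have "[int (h ^ (n + k)) = int 1] (mod int p)" by (simp only: cong_int_iff)
    then have one: "[r ^ (n + k) = 1] (mod int p)"
      using cong_trans[OF rpow[of "n + k"]] by simp
    \<comment> \<open>Inserting the factor r ^ (n + k), which is congruent to 1, lets s ^ n cancel r
      ^ n and leaves r ^ k.\<close>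
    have "[s ^ n = s ^ n * r ^ (n + k)] (mod int p)"
      using cong_mult[OF cong_refl[of "s ^ n"] cong_sym[OF one]] by simp
    also have "s ^ n * r ^ (n + k) = (s ^ n * r ^ n) * r ^ k" by (simp add: power_add)
    also have "[\<dots> = 1 * r ^ k] (mod int p)" by (intro cong_mult sr cong_refl)
    also have "1 * r ^ k = r ^ k" by simp
    also have "[\<dots> = int (h ^ k)] (mod int p)" by (rule rpow)
    finally show ?thesis
      using False
      unfolding power_int_mod_def h_def [symmetric] k_def [symmetric] n_def [symmetric]
        s_def [symmetric] by simp
  qed
qed

text \<open>Both sides say that d * m = n: passing to the complementary divisor is an
  involution.\<close>

lemma div_eq_iff_eq_div:
  fixes d m n :: nat
  assumes "n > 0" "d dvd n" "m dvd n"
  shows "n div d = m \<longleftrightarrow> d = n div m"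
  using assms by (metis dvd_div_mult_self dvd_div_eq_0_iff nonzero_mult_div_cancel_left
      nonzero_mult_div_cancel_right not_gr_zero)

theorem theorem1:
  fixes p m :: nat
  assumes "prime p" and "m > 0" and "m dvd p - 1"
  shows "card {G. (\<exists>g :: int. \<not> int p dvd g \<and> G = exp_graph p g) \<and> m_ary m G}
           = totient ((p - 1) div m)
       \<and> (\<forall>r g a :: int. primitive_root_mod p r \<longrightarrow> [g = power_int_mod p r a] (mod int p) \<longrightarrow>
            (m_ary m (exp_graph p g) \<longleftrightarrow> gcd a (int (p - 1)) = int m))"
proof (intro conjI allI impI)
  have p: "p > 1" using assms(1) prime_gt_1_nat by blast
  have cofactor: "(p - 1) div q dvd p - 1" if "q dvd p - 1" for q
    using that by (metis dvd_div_mult_self dvd_triv_left)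
  \<comment> \<open>These residues will index the m-ary graphs, one residue for each graph.\<close>
  let ?H = "{h \<in> totatives p. ord p h = (p - 1) div m}"
  have ary: "m_ary m (exp_graph p (int h)) \<longleftrightarrow> ord p h = (p - 1) div m" if "coprime p h" for h
  proof -
    have "ord p h dvd p - 1"
      using order_divides_totient[OF that] totient_prime[OF assms(1)] by simp
    then show ?thesis
      using m_ary_exp_graph_iff[OF assms(1) that assms(2)] div_eq_iff_eq_div[of "p - 1" "ord p h" m]
        assms(3) p by simp
  qed
  have "{G. (\<exists>g :: int. \<not> int p dvd g \<and> G = exp_graph p g) \<and> m_ary m G}
      = (\<lambda>h. exp_graph p (int h)) ` ?H"
  proof (intro equalityI subsetI)
    fix G assume "G \<in> {G. (\<exists>g :: int. \<not> int p dvd g \<and> G = exp_graph p g) \<and> m_ary m G}"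
    then obtain g where g: "\<not> int p dvd g" "G = exp_graph p g" "m_ary m G" by auto
    define h where "h = nat (g mod int p)"
    have ih: "int h = g mod int p" using p by (simp add: h_def)
    have "h \<noteq> 0" using g(1) ih by (auto simp: dvd_eq_mod_eq_0)
    have "int h < int p" unfolding ih using p by simp
    then have "h < p" by simp
    with \<open>h \<noteq> 0\<close> have "\<not> p dvd h" by (auto dest: dvd_imp_le)
    then have cop: "coprime p h" using assms(1) by (simp add: prime_imp_coprime)
    have G: "G = exp_graph p (int h)"
      unfolding g(2) by (rule exp_graph_cong) (simp add: ih cong_def)
    have "h \<in> ?H"
      using cop \<open>h \<noteq> 0\<close> \<open>h < p\<close> ary[OF cop] g(3) G
      by (auto simp: totatives_def coprime_commute)
    then show "G \<in> (\<lambda>h. exp_graph p (int h)) ` ?H" using G by blast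
  next
    fix G assume "G \<in> (\<lambda>h. exp_graph p (int h)) ` ?H"
    then obtain h where h: "h \<in> totatives p" "ord p h = (p - 1) div m"
        "G = exp_graph p (int h)" by auto
    have cop: "coprime p h" using h(1) by (simp add: totatives_def coprime_commute)
    then have "\<not> int p dvd int h" using p by (auto simp: coprime_absorb_left)
    then show "G \<in> {G. (\<exists>g :: int. \<not> int p dvd g \<and> G = exp_graph p g) \<and> m_ary m G}"
      using ary[OF cop] h by blast
  qed
  moreover have "inj_on (\<lambda>h. exp_graph p (int h)) ?H"
    using exp_graph_inj_on_totatives[OF assms(1)] by (rule inj_on_subset) auto
  \<comment> \<open>Each divisor q of p - 1 is the order of exactly \<open>totient q\<close>
    residues. Injectivity carries this count over to the graphs.\<close>
  moreover have "(p - 1) div m dvd p - 1" using cofactor assms(3) .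
  then have "card ?H = totient ((p - 1) div m)"
    using prime_card_elements_with_ord_eq_totient[OF p assms(1)] by simp
  ultimately show "card {G. (\<exists>g :: int. \<not> int p dvd g \<and> G = exp_graph p g) \<and> m_ary m G}
      = totient ((p - 1) div m)"
    by (simp add: card_image)

  fix r g a :: int
  assume r: "primitive_root_mod p r" and g: "[g = power_int_mod p r a] (mod int p)"
  define h where "h = nat (r mod int p)"
  define k where "k = nat (a mod int (p - 1))"
  have h: "coprime p h" "ord p h = p - 1"
    using r totient_prime[OF assms(1)]
    by (simp_all add: primitive_root_mod_def residue_primroot_def h_def)
  have "[g = int (h ^ k)] (mod int p)"
    using cong_trans[OF g power_int_mod_cong[OF assms(1) r, of a]]
    by (simp only: h_def k_def)
  then have G: "exp_graph p g = exp_graph p (int (h ^ k))" by (rule exp_graph_cong)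
  \<comment> \<open>Reducing a modulo p - 1 leaves its gcd with p - 1 unchanged.\<close>
  have gcd: "int (gcd k (p - 1)) = gcd a (int (p - 1))"
  proof -
    have "int k = a mod int (p - 1)" using p by (simp add: k_def)
    then have "int (gcd k (p - 1)) = gcd (a mod int (p - 1)) (int (p - 1))"
      by (metis gcd_int_int_eq)
    also have "\<dots> = gcd a (int (p - 1))" by (simp add: gcd.commute gcd_red_int[of a])
    finally show ?thesis .
  qed
  \<comment> \<open>The order of h ^ k is the order p - 1 of h divided by gcd k (p - 1). Taking the
    complementary divisor once more returns the gcd itself.\<close>
  have "m_ary m (exp_graph p g) \<longleftrightarrow> (p - 1) div ((p - 1) div gcd k (p - 1)) = m"
    unfolding G using m_ary_exp_graph_iff[OF assms(1) _ assms(2), of "h ^ k"] h ord_power[OF h(1), of k]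
    by simp
  also have "(p - 1) div ((p - 1) div gcd k (p - 1)) = gcd k (p - 1)"
    using p div_eq_iff_eq_div[of "p - 1" "(p - 1) div gcd k (p - 1)" "gcd k (p - 1)"]
      cofactor[of "gcd k (p - 1)"] by simp
  also have "gcd k (p - 1) = m \<longleftrightarrow> gcd a (int (p - 1)) = int m"
    by (simp only: gcd [symmetric] of_nat_eq_iff)
  finally show "m_ary m (exp_graph p g) \<longleftrightarrow> gcd a (int (p - 1)) = int m" .
qed

end
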